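(* Let $N_x$ and $M_x$ satisfy the Leibniz rule with respect to the variable $x$, and let $W=\langle \omega_0(x),\dots,\omega_s(x)\rangle$ be a real vector space of functions such that $L(\omega)=\lambda(t)\,\omega$ for every $\omega\in W$, where $\lambda(t)$ is a function of $t$. Consider the equations $$(a)\quad \mathcal{O}_t u-A(t)M_x\big(uL(u)\big)=N_xM_xu+A(t)u,\qquad (b)\quad \mathcal{O}_t u-A(t)N_x\big(uL(u)\big)=N_xM_xu+A(t)u .$$ Suppose the functions $b_0(t),\dots,b_s(t)$ are solutions of the system $$\mathcal{O}_t(b_l(t))=A(t)\,b_l(t)\Big[2\lambda(t)\sum_{j=1}^{s}b_j(t)+1\Big]\qquad\text{for all } l\in\{0,\dots,s\},$$ and set $u(x,t)=\sum_{l=0}^{s}b_l(t)\,\omega_l(x)$. Then: - if $N_x(\omega_l)=M_x(\omega_l)=1$ for all $l\neq 0$ and $N_x(\omega_0)=M_x(\omega_0)=0$, then $u$ is a solution of (a) and of (b); - if $M_x(\omega_l)=1$ for all $l\neq 0$ and $M_x(\omega_0)=0$, then $u$ is a solution of (a).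
   Context: $\mathcal{O}_t$ is a linear differential operator acting only on the variable $t$ (so $\mathcal{O}_t(b(t)\omega(x))=\omega(x)\,\mathcal{O}_t(b(t))$); it is not assumed to satisfy the Leibniz rule and may be, for example, a Caputo-type fractional derivative. $N_x$ and $M_x$ are linear differential operators acting only on the variable $x$, and $L$ is a linear operator acting only on the variable $x$; in particular these three commute with multiplication by functions of $t$ alone. An operator $D$ satisfies the Leibniz rule if $D(vw)=vD(w)+wD(v)$. $N_xM_x$ denotes composition. $A(t)$ is a given function of $t$. $\langle\cdot\rangle$ denotes the real linear span. Functions are regular enough that all expressions are defined. *)

theory Defs
  imports Complex_Main
begin

text \<open>
  Functions of one variable are total functions of which only the values on a given set \<open>S\<close>
  matter. Operators are defined on a class \<open>F\<close> of sufficiently regular functions and not on all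
  functions: the only derivation on the algebra of all real functions is zero. They may leave \<open>F\<close>.
\<close>

definition function_space :: "'a set \<Rightarrow> ('a \<Rightarrow> real) set \<Rightarrow> bool" where
  "function_space S F \<longleftrightarrow>
     (\<lambda>_. 0) \<in> F \<and>
     (\<forall>f\<in>F. \<forall>g\<in>F. (\<lambda>y. f y + g y) \<in> F) \<and>
     (\<forall>c. \<forall>f\<in>F. (\<lambda>y. c * f y) \<in> F) \<and>
     (\<forall>f\<in>F. \<forall>g. (\<forall>y\<in>S. g y = f y) \<longrightarrow> g \<in> F)"

definition function_algebra :: "'a set \<Rightarrow> ('a \<Rightarrow> real) set \<Rightarrow> bool" where
  "function_algebra S F \<longleftrightarrow>
     function_space S F \<and> (\<lambda>_. 1) \<in> F \<and> (\<forall>f\<in>F. \<forall>g\<in>F. (\<lambda>y. f y * g y) \<in> F)"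

definition linear_operator_on ::
  "'a set \<Rightarrow> ('a \<Rightarrow> real) set \<Rightarrow> (('a \<Rightarrow> real) \<Rightarrow> ('a \<Rightarrow> real)) \<Rightarrow> bool" where
  "linear_operator_on S F P \<longleftrightarrow>
     function_space S F \<and>
     (\<forall>f\<in>F. \<forall>g\<in>F. \<forall>y\<in>S. P (\<lambda>z. f z + g z) y = P f y + P g y) \<and>
     (\<forall>c. \<forall>f\<in>F. \<forall>y\<in>S. P (\<lambda>z. c * f z) y = c * P f y) \<and>
     (\<forall>f\<in>F. \<forall>g\<in>F. (\<forall>y\<in>S. f y = g y) \<longrightarrow> (\<forall>y\<in>S. P f y = P g y))"

definition leibniz_on ::
  "'a set \<Rightarrow> ('a \<Rightarrow> real) set \<Rightarrow> (('a \<Rightarrow> real) \<Rightarrow> ('a \<Rightarrow> real)) \<Rightarrow> bool" where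
  "leibniz_on S F P \<longleftrightarrow>
     (\<forall>v\<in>F. \<forall>w\<in>F. \<forall>y\<in>S. P (\<lambda>z. v z * w z) y = v y * P w y + w y * P v y)"

definition lin_span :: "nat \<Rightarrow> (nat \<Rightarrow> 'a \<Rightarrow> real) \<Rightarrow> ('a \<Rightarrow> real) set" where
  "lin_span s \<omega> = {f. \<exists>c. f = (\<lambda>x. \<Sum>l\<le>s. c l * \<omega> l x)}"

text \<open>
  Action on functions \<open>u x t\<close> of two variables. An operator that acts only on \<open>x\<close> is applied to
  \<open>u(\<cdot>, t)\<close> with \<open>t\<close> frozen. Its coefficients may depend on \<open>t\<close>, as \<open>L(\<omega>) = \<lambda>(t) \<omega>\<close> requires;
  hence it is a family indexed by \<open>t\<close>.
\<close>

definition act_x ::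
  "(real \<Rightarrow> ('a \<Rightarrow> real) \<Rightarrow> ('a \<Rightarrow> real)) \<Rightarrow> ('a \<Rightarrow> real \<Rightarrow> real) \<Rightarrow> ('a \<Rightarrow> real \<Rightarrow> real)" where
  "act_x P u = (\<lambda>x t. P t (\<lambda>y. u y t) x)"

definition act_t ::
  "((real \<Rightarrow> real) \<Rightarrow> (real \<Rightarrow> real)) \<Rightarrow> ('a \<Rightarrow> real \<Rightarrow> real) \<Rightarrow> ('a \<Rightarrow> real \<Rightarrow> real)" where
  "act_t Q u = (\<lambda>x t. Q (\<lambda>\<tau>. u x \<tau>) t)"

text \<open>
  All operators in the equations are applied inside their domains: \<open>F\<close> is the domain of \<open>N\<close> and
  \<open>M\<close>, \<open>DL\<close> that of \<open>L\<close>, and \<open>DO\<close> that of the operator in \<open>t\<close>.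
\<close>

definition well_defined_terms ::
  "'a set \<Rightarrow> real set \<Rightarrow> ('a \<Rightarrow> real) set \<Rightarrow> ('a \<Rightarrow> real) set \<Rightarrow> (real \<Rightarrow> real) set \<Rightarrow>
   (real \<Rightarrow> ('a \<Rightarrow> real) \<Rightarrow> ('a \<Rightarrow> real)) \<Rightarrow> (real \<Rightarrow> ('a \<Rightarrow> real) \<Rightarrow> ('a \<Rightarrow> real)) \<Rightarrow>
   ('a \<Rightarrow> real \<Rightarrow> real) \<Rightarrow> bool" where
  "well_defined_terms X T F DL DO M L u \<longleftrightarrow>
     (\<forall>x\<in>X. (\<lambda>t. u x t) \<in> DO) \<and>
     (\<forall>t\<in>T. (\<lambda>x. u x t) \<in> F \<and> (\<lambda>x. u x t) \<in> DL \<and>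
        (\<lambda>x. u x t * act_x L u x t) \<in> F \<and> (\<lambda>x. act_x M u x t) \<in> F)"

definition solves_a ::
  "'a set \<Rightarrow> real set \<Rightarrow> ('a \<Rightarrow> real) set \<Rightarrow> ('a \<Rightarrow> real) set \<Rightarrow> (real \<Rightarrow> real) set \<Rightarrow>
   ((real \<Rightarrow> real) \<Rightarrow> (real \<Rightarrow> real)) \<Rightarrow>
   (real \<Rightarrow> ('a \<Rightarrow> real) \<Rightarrow> ('a \<Rightarrow> real)) \<Rightarrow> (real \<Rightarrow> ('a \<Rightarrow> real) \<Rightarrow> ('a \<Rightarrow> real)) \<Rightarrow>
   (real \<Rightarrow> ('a \<Rightarrow> real) \<Rightarrow> ('a \<Rightarrow> real)) \<Rightarrow> (real \<Rightarrow> real) \<Rightarrow>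
   ('a \<Rightarrow> real \<Rightarrow> real) \<Rightarrow> bool" where
  "solves_a X T F DL DO Ot N M L A u \<longleftrightarrow>
     well_defined_terms X T F DL DO M L u \<and>
     (\<forall>x\<in>X. \<forall>t\<in>T.
        act_t Ot u x t - A t * act_x M (\<lambda>x t. u x t * act_x L u x t) x t
          = act_x N (act_x M u) x t + A t * u x t)"

definition solves_b ::
  "'a set \<Rightarrow> real set \<Rightarrow> ('a \<Rightarrow> real) set \<Rightarrow> ('a \<Rightarrow> real) set \<Rightarrow> (real \<Rightarrow> real) set \<Rightarrow>
   ((real \<Rightarrow> real) \<Rightarrow> (real \<Rightarrow> real)) \<Rightarrow>
   (real \<Rightarrow> ('a \<Rightarrow> real) \<Rightarrow> ('a \<Rightarrow> real)) \<Rightarrow> (real \<Rightarrow> ('a \<Rightarrow> real) \<Rightarrow> ('a \<Rightarrow> real)) \<Rightarrow>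
   (real \<Rightarrow> ('a \<Rightarrow> real) \<Rightarrow> ('a \<Rightarrow> real)) \<Rightarrow> (real \<Rightarrow> real) \<Rightarrow>
   ('a \<Rightarrow> real \<Rightarrow> real) \<Rightarrow> bool" where
  "solves_b X T F DL DO Ot N M L A u \<longleftrightarrow>
     well_defined_terms X T F DL DO M L u \<and>
     (\<forall>x\<in>X. \<forall>t\<in>T.
        act_t Ot u x t - A t * act_x N (\<lambda>x t. u x t * act_x L u x t) x t
          = act_x N (act_x M u) x t + A t * u x t)"

end

(* If D = M (respectively N) is normalised on the \<omega>_l, then D u is the function
   B(t) = b_1 + ... + b_s of t alone, and Leibniz gives D(\<lambda> u^2) = 2 \<lambda> u D u = 2 \<lambda> u B.
   Since M u does not depend on x, N M u = 0, and the equation reduces to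
   O_t u = A u (2 \<lambda> B + 1), the sum of the equations for the b_l weighted by \<omega>_l(x). *)
theory Submission
  imports Defs
begin

lemma function_spaceD:
  assumes "function_space S F"
  shows function_space_zero: "(\<lambda>_. 0) \<in> F"
    and function_space_add: "f \<in> F \<Longrightarrow> g \<in> F \<Longrightarrow> (\<lambda>y. f y + g y) \<in> F"
    and function_space_scale: "f \<in> F \<Longrightarrow> (\<lambda>y. c * f y) \<in> F"
    and function_space_cong: "f \<in> F \<Longrightarrow> (\<And>y. y \<in> S \<Longrightarrow> g y = f y) \<Longrightarrow> g \<in> F"
  using assms unfolding function_space_def by blast+

lemma function_algebraD:
  assumes "function_algebra S F"
  shows function_algebra_space: "function_space S F"
    and function_algebra_const: "(\<lambda>_. c) \<in> F"
    and function_algebra_mult: "f \<in> F \<Longrightarrow> g \<in> F \<Longrightarrow> (\<lambda>y. f y * g y) \<in> F"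
proof -
  show sp: "function_space S F"
    using assms unfolding function_algebra_def by blast
  have "(\<lambda>_. 1) \<in> F"
    using assms unfolding function_algebra_def by blast
  from function_space_scale[OF sp this, of c] show "(\<lambda>_. c) \<in> F"
    by simp
  show "f \<in> F \<Longrightarrow> g \<in> F \<Longrightarrow> (\<lambda>y. f y * g y) \<in> F"
    using assms unfolding function_algebra_def by blast
qed

lemma linear_operator_onD:
  assumes "linear_operator_on S F P"
  shows linear_operator_on_space: "function_space S F"
    and linear_operator_on_add:
      "f \<in> F \<Longrightarrow> g \<in> F \<Longrightarrow> y \<in> S \<Longrightarrow> P (\<lambda>z. f z + g z) y = P f y + P g y"
    and linear_operator_on_scale:
      "f \<in> F \<Longrightarrow> y \<in> S \<Longrightarrow> P (\<lambda>z. c * f z) y = c * P f y"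
    and linear_operator_on_cong:
      "f \<in> F \<Longrightarrow> g \<in> F \<Longrightarrow> (\<And>y. y \<in> S \<Longrightarrow> f y = g y) \<Longrightarrow> y \<in> S \<Longrightarrow> P f y = P g y"
  using assms unfolding linear_operator_on_def by blast+

lemma leibniz_onD:
  assumes "leibniz_on S F P" "v \<in> F" "w \<in> F" "y \<in> S"
  shows "P (\<lambda>z. v z * w z) y = v y * P w y + w y * P v y"
  using assms unfolding leibniz_on_def by blast

lemma function_space_sum:
  assumes "function_space S F" and "\<And>l. l \<in> I \<Longrightarrow> f l \<in> F"
  shows "(\<lambda>y. \<Sum>l\<in>I. c l * f l y) \<in> F"
  using assms(2)
\<comment> \<open>A sum over an infinite index set is 0 by convention, so that case and the empty
  one both come down to the zero function.\<close>
proof (induction I rule: infinite_finite_induct)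
  case (insert l I)
  then show ?case
    using function_space_add[OF assms(1) function_space_scale[OF assms(1)]] by simp
qed (simp_all add: function_space_zero[OF assms(1)])

lemma linear_operator_on_zero:
  assumes "linear_operator_on S F P" and "y \<in> S"
  shows "P (\<lambda>_. 0) y = 0"
  using linear_operator_on_scale
    [OF assms(1) function_space_zero[OF linear_operator_on_space[OF assms(1)]] assms(2), of 0]
  by simp

lemma linear_operator_on_sum:
  assumes lin: "linear_operator_on S F P"
    and "\<And>l. l \<in> I \<Longrightarrow> f l \<in> F" and y: "y \<in> S"
  shows "P (\<lambda>z. \<Sum>l\<in>I. c l * f l z) y = (\<Sum>l\<in>I. c l * P (f l) y)"
  using assms(2)
proof (induction I rule: infinite_finite_induct)
  case (insert l I)
  note sp = linear_operator_on_space[OF lin]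
  have "P (\<lambda>z. c l * f l z + (\<Sum>l\<in>I. c l * f l z)) y
      = c l * P (f l) y + P (\<lambda>z. \<Sum>l\<in>I. c l * f l z) y"
    using insert.prems
    by (subst linear_operator_on_add[OF lin])
       (auto intro!: function_space_scale[OF sp] function_space_sum[OF sp]
          simp: y linear_operator_on_scale[OF lin])
  with insert show ?case
    by simp
qed (simp_all add: linear_operator_on_zero[OF lin y])

text \<open>Leibniz on 1 * 1 = 1 gives P 1 = 2 P 1, hence P 1 = 0, and linearity carries this to
  every constant. It is what makes N M u vanish.\<close>

lemma derivation_const:
  assumes alg: "function_algebra S F" and lin: "linear_operator_on S F P"
    and leib: "leibniz_on S F P" and y: "y \<in> S"
  shows "P (\<lambda>_. c) y = 0"
proof -
  note one = function_algebra_const[OF alg, of 1]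
  have "P (\<lambda>_. 1) y = 0"
    using leibniz_onD[OF leib one one y] by simp
  with linear_operator_on_scale[OF lin one y, of c] show ?thesis
    by simp
qed

text \<open>In P(v w) = v P w + w P v both summands equal k v P v. The factor \<open>w\<close> is
  tied to \<open>k * v\<close> only on \<open>S\<close>, because in the application \<open>w\<close>
  is L u, whose values off \<open>X\<close> are unknown; for the same reason \<open>w\<close> being
  in \<open>F\<close> has to be derived.\<close>

lemma derivation_mult_scaled_self:
  assumes alg: "function_algebra S F" and lin: "linear_operator_on S F P"
    and leib: "leibniz_on S F P"
    and v: "v \<in> F" and w: "\<And>z. z \<in> S \<Longrightarrow> w z = k * v z" and y: "y \<in> S"
  shows "P (\<lambda>z. v z * w z) y = 2 * k * v y * P v y"
proof -
  note sp = function_algebra_space[OF alg]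
  have kv: "(\<lambda>z. k * v z) \<in> F"
    by (rule function_space_scale[OF sp v])
  have "w \<in> F"
    by (rule function_space_cong[OF sp kv w])
  then have "P (\<lambda>z. v z * w z) y = v y * P w y + w y * P v y"
    by (rule leibniz_onD[OF leib v _ y])
  also have "P w y = k * P v y"
    using linear_operator_on_cong[OF lin \<open>w \<in> F\<close> kv w y] linear_operator_on_scale[OF lin v y]
    by simp
  finally show ?thesis
    using w[OF y] by simp
qed

lemma linear_operator_on_combination:
  fixes f :: "nat \<Rightarrow> 'a \<Rightarrow> real"
  assumes "linear_operator_on S F P" and "\<And>l. l \<le> s \<Longrightarrow> f l \<in> F" and "y \<in> S"
    and "P (f 0) y = 0" and "\<And>l. l \<in> {1..s} \<Longrightarrow> P (f l) y = 1"
  shows "P (\<lambda>z. \<Sum>l\<le>s. c l * f l z) y = (\<Sum>l=1..s. c l)"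
proof -
  have "P (\<lambda>z. \<Sum>l\<le>s. c l * f l z) y = (\<Sum>l\<le>s. c l * P (f l) y)"
    using assms(1-3) by (intro linear_operator_on_sum) auto
  \<comment> \<open>The only index lost is 0, and its term vanishes because
    \<open>P (f 0) y = 0\<close>.\<close>
  also have "\<dots> = (\<Sum>l=1..s. c l * P (f l) y)"
    using assms(4) by (intro sum.mono_neutral_right) (auto simp: not_le)
  also have "\<dots> = (\<Sum>l=1..s. c l)"
    using assms(5) by (intro sum.cong) auto
  finally show ?thesis .
qed

theorem proposition3p1:
  fixes X :: "'a set" and T :: "real set"
    and F DL :: "('a \<Rightarrow> real) set" and DO :: "(real \<Rightarrow> real) set"
    and Ot :: "(real \<Rightarrow> real) \<Rightarrow> (real \<Rightarrow> real)"
    and N M L :: "real \<Rightarrow> ('a \<Rightarrow> real) \<Rightarrow> ('a \<Rightarrow> real)"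
    and A lam :: "real \<Rightarrow> real"
    and s :: nat and \<omega> :: "nat \<Rightarrow> 'a \<Rightarrow> real" and b :: "nat \<Rightarrow> real \<Rightarrow> real"
    and u :: "'a \<Rightarrow> real \<Rightarrow> real"
  assumes "function_algebra X F"
    and "linear_operator_on T DO Ot"
    and "\<forall>t\<in>T. linear_operator_on X F (N t) \<and> leibniz_on X F (N t)"
    and "\<forall>t\<in>T. linear_operator_on X F (M t) \<and> leibniz_on X F (M t)"
    and "\<forall>t\<in>T. linear_operator_on X DL (L t)"
    and "\<forall>l\<le>s. \<omega> l \<in> F \<and> \<omega> l \<in> DL"
    and "\<forall>l\<le>s. b l \<in> DO"
    and "\<forall>w\<in>lin_span s \<omega>. \<forall>t\<in>T. \<forall>x\<in>X. L t w x = lam t * w x"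
    and "\<forall>l\<le>s. \<forall>t\<in>T. Ot (b l) t = A t * b l t * (2 * lam t * (\<Sum>j=1..s. b j t) + 1)"
    and "u = (\<lambda>x t. \<Sum>l\<le>s. b l t * \<omega> l x)"
  shows
    "((\<forall>l\<in>{1..s}. \<forall>t\<in>T. \<forall>x\<in>X. N t (\<omega> l) x = 1 \<and> M t (\<omega> l) x = 1) \<and>
      (\<forall>t\<in>T. \<forall>x\<in>X. N t (\<omega> 0) x = 0 \<and> M t (\<omega> 0) x = 0)
        \<longrightarrow> solves_a X T F DL DO Ot N M L A u \<and> solves_b X T F DL DO Ot N M L A u) \<and>
     ((\<forall>l\<in>{1..s}. \<forall>t\<in>T. \<forall>x\<in>X. M t (\<omega> l) x = 1) \<and>
      (\<forall>t\<in>T. \<forall>x\<in>X. M t (\<omega> 0) x = 0)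
        \<longrightarrow> solves_a X T F DL DO Ot N M L A u)"
proof -
  note [simp] = act_x_def act_t_def
  note alg = assms(1) and linO = assms(2) and lam_eig = assms(8) and b_eq = assms(9)
    and u_def = assms(10)
  note spF = function_algebra_space[OF alg] and spO = linear_operator_on_space[OF linO]
  define B where "B t = (\<Sum>j=1..s. b j t)" for t
  have linN: "linear_operator_on X F (N t)" and leibN: "leibniz_on X F (N t)"
    and linM: "linear_operator_on X F (M t)" and leibM: "leibniz_on X F (M t)"
    and linL: "linear_operator_on X DL (L t)" if "t \<in> T" for t
    using assms(3-5) that by blast+
  have \<omega>: "\<omega> l \<in> F" "\<omega> l \<in> DL" and b: "b l \<in> DO" if "l \<le> s" for l
    using assms(6,7) that by blast+
  have uF: "(\<lambda>x. u x t) \<in> F" for t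
    unfolding u_def by (rule function_space_sum[OF spF]) (simp add: \<omega>)
  have uDL: "(\<lambda>x. u x t) \<in> DL" if "t \<in> T" for t
    unfolding u_def
    by (rule function_space_sum[OF linear_operator_on_space[OF linL[OF that]]]) (simp add: \<omega>)
  \<comment> \<open>For fixed x the roles are exchanged: the numbers \<open>\<omega> l x\<close>
    become the coefficients and the functions \<open>b l\<close> the summands, so the same sum
    lemmas serve the operator in t.\<close>
  have u_swap: "u x = (\<lambda>t. \<Sum>l\<le>s. \<omega> l x * b l t)" for x
    by (simp add: u_def mult.commute)
  have uDO: "u x \<in> DO" for x
    unfolding u_swap by (rule function_space_sum[OF spO]) (simp add: b)
  have Lu: "L t (\<lambda>x. u x t) x = lam t * u x t" if "t \<in> T" "x \<in> X" for t x
  proof -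
    \<comment> \<open>With t frozen, the \<open>b l t\<close> are real coefficients, so the
      eigenvalue hypothesis on the span applies to u(., t) directly.\<close>
    have "(\<lambda>x. u x t) \<in> lin_span s \<omega>"
      unfolding lin_span_def u_def mem_Collect_eq by (intro exI[of _ "\<lambda>l. b l t"] refl)
    with lam_eig that show ?thesis by blast
  qed
  \<comment> \<open>\<open>L\<close> may lead out of \<open>F\<close>. Here L u agrees on
    \<open>X\<close> with \<open>lam t\<close> times u, which lies in \<open>F\<close>, and
    membership in \<open>F\<close> is insensitive to values off \<open>X\<close>.\<close>
  have uLuF: "(\<lambda>x. u x t * L t (\<lambda>x. u x t) x) \<in> F" if "t \<in> T" for t
    by (rule function_algebra_mult[OF alg uF function_space_cong[OF spF
          function_space_scale[OF spF uF]]]) (rule Lu[OF that])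
  have Ou: "Ot (u x) t = A t * u x t * (2 * lam t * B t + 1)" if "t \<in> T" for x t
  proof -
    have "Ot (u x) t = (\<Sum>l\<le>s. \<omega> l x * Ot (b l) t)"
      unfolding u_swap using b that by (intro linear_operator_on_sum[OF linO]) auto
    also have "\<dots> = (\<Sum>l\<le>s. A t * (2 * lam t * B t + 1) * (\<omega> l x * b l t))"
      using b_eq that by (intro sum.cong) (simp_all add: B_def)
    also have "\<dots> = A t * u x t * (2 * lam t * B t + 1)"
      by (simp add: u_swap sum_distrib_left mult_ac)
    finally show ?thesis .
  qed
  have normalised: "P (\<lambda>y. u y t) x = B t"
    if "linear_operator_on X F P" "x \<in> X" "P (\<omega> 0) x = 0" "\<And>l. l \<in> {1..s} \<Longrightarrow> P (\<omega> l) x = 1"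
    for P x t
    unfolding u_def B_def using that \<omega>(1) by (intro linear_operator_on_combination) auto
  \<comment> \<open>Both equations contain N M u, so this part is shared. It rests on M u = B alone:
    nothing is assumed about N on the \<omega>_l, since N only meets a constant in x.\<close>
  have wd: "well_defined_terms X T F DL DO M L u"
    and NMu: "\<And>t x. t \<in> T \<Longrightarrow> x \<in> X \<Longrightarrow> N t (M t (\<lambda>y. u y t)) x = 0"
    if Mu: "\<And>t x. t \<in> T \<Longrightarrow> x \<in> X \<Longrightarrow> M t (\<lambda>y. u y t) x = B t"
  proof -
    have MuF: "M t (\<lambda>y. u y t) \<in> F" if "t \<in> T" for t
      by (rule function_space_cong[OF spF function_algebra_const[OF alg, of "B t"]])
         (rule Mu[OF that])
    then show "well_defined_terms X T F DL DO M L u"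
      unfolding well_defined_terms_def using uF uDL uDO uLuF by simp
    show "N t (M t (\<lambda>y. u y t)) x = 0" if t: "t \<in> T" and x: "x \<in> X" for t x
    proof -
      \<comment> \<open>M u is known to be the constant \<open>B t\<close> only on \<open>X\<close>,
        so the two functions are exchanged by congruence on \<open>X\<close> and not by
        equality.\<close>
      have "N t (M t (\<lambda>y. u y t)) x = N t (\<lambda>_. B t) x"
        by (rule linear_operator_on_cong[OF linN[OF t] MuF[OF t]
              function_algebra_const[OF alg] _ x]) (rule Mu[OF t])
      with derivation_const[OF alg linN[OF t] leibN[OF t] x] show ?thesis
        by simp
    qed
  qed
  have eq_a: "solves_a X T F DL DO Ot N M L A u"
    if Mu: "\<And>t x. t \<in> T \<Longrightarrow> x \<in> X \<Longrightarrow> M t (\<lambda>y. u y t) x = B t"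
  proof -
    have "M t (\<lambda>y. u y t * L t (\<lambda>y. u y t) y) x = 2 * lam t * u x t * B t"
      if "t \<in> T" "x \<in> X" for t x
      using derivation_mult_scaled_self[OF alg linM leibM uF Lu] Mu that by simp
    \<comment> \<open>The nonlinear term contributes A * 2 lam u B, which is exactly the excess of
      \<open>Ou\<close> over A u; N M u adds nothing.\<close>
    then show ?thesis
      unfolding solves_a_def using wd[OF Mu] NMu[OF Mu] Ou by (simp add: algebra_simps)
  qed
  \<comment> \<open>\<open>Nu\<close> evaluates the nonlinear term, while \<open>Mu\<close> is still
    required for N M u = 0 and for M u to lie in \<open>F\<close>.\<close>
  have eq_b: "solves_b X T F DL DO Ot N M L A u"
    if Mu: "\<And>t x. t \<in> T \<Longrightarrow> x \<in> X \<Longrightarrow> M t (\<lambda>y. u y t) x = B t"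
      and Nu: "\<And>t x. t \<in> T \<Longrightarrow> x \<in> X \<Longrightarrow> N t (\<lambda>y. u y t) x = B t"
  proof -
    have "N t (\<lambda>y. u y t * L t (\<lambda>y. u y t) y) x = 2 * lam t * u x t * B t"
      if "t \<in> T" "x \<in> X" for t x
      using derivation_mult_scaled_self[OF alg linN leibN uF Lu] Nu that by simp
    then show ?thesis
      unfolding solves_b_def using wd[OF Mu] NMu[OF Mu] Ou by (simp add: algebra_simps)
  qed
  show ?thesis
    using eq_a eq_b normalised[OF linM] normalised[OF linN] by simp
qed

end
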